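(* Assume Martin's Axiom. Then there exists a weak selection $f$ on $\mathbb{R}$ such that $\mathcal{N}_f$ is exactly the $\sigma$-ideal of meager subsets of $\mathbb{R}$ (with the Euclidean topology).
   Context: A weak selection on $\mathbb{R}$ is a function $f:[\mathbb{R}]^2\to\mathbb{R}$ with $f(F)\in F$ for every two-element set $F\subseteq\mathbb{R}$. For distinct $x,y$ write $x<_f y$ if $f(\{x,y\})=x$, and $x\leq_f y$ if $x<_f y$ or $x=y$. For $r,s\in\mathbb{R}$, $(r,s]_f=\{x\in\mathbb{R}: r<_f x\leq_f s\}$ (it is not required that $r<_f s$). For $A\subseteq\mathbb{R}$, $\lambda_f(A)=\inf\{\sum_{n\in\mathbb{N}}|s_n-r_n| : A\subseteq\bigcup_{n\in\mathbb{N}}(r_n,s_n]_f\}$ if $A$ can be covered by countably many intervals $(r,s]_f$, and $\lambda_f(A)=+\infty$ otherwise. $\mathcal{N}_f=\{A\subseteq\mathbb{R}:\lambda_f(A)=0\}$. *)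

theory Defs
  imports "HOL-Analysis.Analysis" "HOL-Library.Equipollence"
begin

text \<open>A weak selection is a function on all sets of reals; its values on sets that do not have
  exactly two elements are irrelevant and never used.\<close>

definition weak_selection :: "(real set \<Rightarrow> real) \<Rightarrow> bool" where
  "weak_selection f \<longleftrightarrow> (\<forall>F. card F = 2 \<longrightarrow> f F \<in> F)"

definition sel_less :: "(real set \<Rightarrow> real) \<Rightarrow> real \<Rightarrow> real \<Rightarrow> bool" where
  "sel_less f x y \<longleftrightarrow> x \<noteq> y \<and> f {x, y} = x"

definition sel_le :: "(real set \<Rightarrow> real) \<Rightarrow> real \<Rightarrow> real \<Rightarrow> bool" where
  "sel_le f x y \<longleftrightarrow> sel_less f x y \<or> x = y"

definition sel_interval :: "(real set \<Rightarrow> real) \<Rightarrow> real \<Rightarrow> real \<Rightarrow> real set" where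
  "sel_interval f r s = {x. sel_less f r x \<and> sel_le f x s}"

text \<open>If no countable cover exists, the infimum is taken over the empty set and equals \<open>\<infinity>\<close>.\<close>

definition sel_measure :: "(real set \<Rightarrow> real) \<Rightarrow> real set \<Rightarrow> ennreal" where
  "sel_measure f A =
     Inf {(\<Sum>n. ennreal \<bar>s n - r n\<bar>) | r s :: nat \<Rightarrow> real. A \<subseteq> (\<Union>n. sel_interval f (r n) (s n))}"

definition sel_null :: "(real set \<Rightarrow> real) \<Rightarrow> real set set" where
  "sel_null f = {A. sel_measure f A = 0}"


definition nowhere_dense :: "'a::topological_space set \<Rightarrow> bool" where
  "nowhere_dense A \<longleftrightarrow> interior (closure A) = {}"

definition meager :: "'a::topological_space set \<Rightarrow> bool" where
  "meager A \<longleftrightarrow> (\<exists>B :: nat \<Rightarrow> 'a set. (\<forall>n. nowhere_dense (B n)) \<and> A = (\<Union>n. B n))"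


text \<open>A partial order is given by a carrier \<open>P\<close> and a relation \<open>R\<close> on it, where \<open>(p, q) \<in> R\<close>
  means \<open>p \<le> q\<close>, i.e. \<open>p\<close> is the stronger condition.\<close>

definition compatible :: "'p set \<Rightarrow> 'p rel \<Rightarrow> 'p \<Rightarrow> 'p \<Rightarrow> bool" where
  "compatible P R p q \<longleftrightarrow> (\<exists>t\<in>P. (t, p) \<in> R \<and> (t, q) \<in> R)"

definition ccc :: "'p set \<Rightarrow> 'p rel \<Rightarrow> bool" where
  "ccc P R \<longleftrightarrow>
     (\<forall>A\<subseteq>P. (\<forall>p\<in>A. \<forall>q\<in>A. p \<noteq> q \<longrightarrow> \<not> compatible P R p q) \<longrightarrow> countable A)"

definition dense_in :: "'p set \<Rightarrow> 'p rel \<Rightarrow> 'p set \<Rightarrow> bool" where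
  "dense_in P R D \<longleftrightarrow> D \<subseteq> P \<and> (\<forall>p\<in>P. \<exists>d\<in>D. (d, p) \<in> R)"

definition filter_in :: "'p set \<Rightarrow> 'p rel \<Rightarrow> 'p set \<Rightarrow> bool" where
  "filter_in P R G \<longleftrightarrow> G \<subseteq> P \<and> G \<noteq> {} \<and>
     (\<forall>p\<in>G. \<forall>q\<in>P. (p, q) \<in> R \<longrightarrow> q \<in> G) \<and>
     (\<forall>p\<in>G. \<forall>q\<in>G. \<exists>t\<in>G. (t, p) \<in> R \<and> (t, q) \<in> R)"

definition martins_axiom_on :: "'p itself \<Rightarrow> bool" where
  "martins_axiom_on _ \<longleftrightarrow>
     (\<forall>(P :: 'p set) R \<D>.
        P \<noteq> {} \<and> partial_order_on P R \<and> ccc P R \<and>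
        \<D> \<prec> (UNIV :: real set) \<and> (\<forall>D\<in>\<D>. dense_in P R D) \<longrightarrow>
        (\<exists>G. filter_in P R G \<and> (\<forall>D\<in>\<D>. G \<inter> D \<noteq> {})))"

text \<open>HOL cannot quantify over all types inside a formula, so Martin's Axiom is stated for partial
  orders whose carrier is an arbitrary set of reals. By the theorem \<open>martins_axiom_imp_on\<close> below this
  implies the same assertion for partial orders over every type, of whatever cardinality.\<close>

abbreviation martins_axiom :: bool where
  "martins_axiom \<equiv> martins_axiom_on TYPE(real)"

lemma martins_axiom_onD:
  fixes P :: "'p set"
  assumes "martins_axiom_on TYPE('p)" "P \<noteq> {}" "partial_order_on P R" "ccc P R"
    and "\<D> \<prec> (UNIV :: real set)" "\<And>D. D \<in> \<D> \<Longrightarrow> dense_in P R D"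
  shows "\<exists>G. filter_in P R G \<and> (\<forall>D\<in>\<D>. G \<inter> D \<noteq> {})"
  using assms unfolding martins_axiom_on_def by blast

lemma lepoll_real_Times:
  assumes "A \<lesssim> (UNIV :: real set)" "B \<lesssim> (UNIV :: real set)"
  shows "A \<times> B \<lesssim> (UNIV :: real set)"
proof -
  have "A \<times> B \<lesssim> (UNIV :: real set) \<times> (UNIV :: real set)"
    using assms by (rule times_lepoll_mono)
  also have "(UNIV :: real set) \<times> (UNIV :: real set) \<approx> (UNIV :: real set)"
    using card_of_Times_same_infinite[of "UNIV :: real set"]
    by (simp add: infinite_UNIV_char_0 eqpoll_def card_of_ordIso)
  finally show ?thesis .
qed

lemma lepoll_real_UN:
  assumes "\<And>n::nat. A n \<lesssim> (UNIV :: real set)"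
  shows "(\<Union>n. A n) \<lesssim> (UNIV :: real set)"
proof -
  have "(card_of (\<Union>n. A n), card_of (UNIV :: real set)) \<in> ordLeq"
  proof (rule card_of_UNION_ordLeq_infinite)
    show "(card_of (UNIV :: nat set), card_of (UNIV :: real set)) \<in> ordLeq"
      by (simp add: infinite_iff_card_of_nat[symmetric] infinite_UNIV_char_0)
    show "\<forall>n\<in>UNIV. (card_of (A n), card_of (UNIV :: real set)) \<in> ordLeq"
      using assms by (simp add: lepoll_def card_of_ordLeq[symmetric])
  qed (simp add: infinite_UNIV_char_0)
  thus ?thesis by (simp add: lepoll_def card_of_ordLeq[symmetric])
qed

lemma lepoll_real_Un:
  assumes "A \<lesssim> (UNIV :: real set)" "B \<lesssim> (UNIV :: real set)"
  shows "A \<union> B \<lesssim> (UNIV :: real set)"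
proof -
  have "A \<union> B = (\<Union>n::nat. if n = 0 then A else B)" by (auto split: if_splits)
  thus ?thesis using lepoll_real_UN[of "\<lambda>n. if n = 0 then A else B"] assms by simp
qed

lemma martins_axiom_on_transfer:
  fixes h :: "'p \<Rightarrow> 'q" and Q :: "'p set"
  assumes MA: "martins_axiom_on TYPE('q)" and inj: "inj_on h Q"
    and ne: "Q \<noteq> {}" and po: "partial_order_on Q R" and ccc: "ccc Q R"
    and small: "\<D> \<prec> (UNIV :: real set)" and dense: "\<And>D. D \<in> \<D> \<Longrightarrow> dense_in Q R D"
  shows "\<exists>G. filter_in Q R G \<and> (\<forall>D\<in>\<D>. G \<inter> D \<noteq> {})"
proof -
  define S where "S = map_prod h h ` R"
  have RQ: "R \<subseteq> Q \<times> Q"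
    using po by (auto simp: partial_order_on_def preorder_on_def refl_on_def)
  have S_iff: "(h a, h b) \<in> S \<longleftrightarrow> (a, b) \<in> R" if "a \<in> Q" "b \<in> Q" for a b
  proof
    assume "(h a, h b) \<in> S"
    then obtain x y where xy: "(x, y) \<in> R" "h a = h x" "h b = h y" by (auto simp: S_def)
    hence "a = x" "b = y" using RQ that inj by (auto simp: inj_on_def)
    thus "(a, b) \<in> R" using xy by simp
  qed (auto simp: S_def)
  have refl: "\<And>a. a \<in> Q \<Longrightarrow> (a, a) \<in> R" and tr: "trans R" and anti: "antisym R"
    using po by (auto simp: partial_order_on_def preorder_on_def refl_on_def)
  have poS: "partial_order_on (h ` Q) S"
    unfolding partial_order_on_def preorder_on_def
  proof (intro conjI)
    show "S \<subseteq> h ` Q \<times> h ` Q" using RQ by (auto simp: S_def)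
    show "refl_on (h ` Q) S" using refl by (auto simp: refl_on_def S_def)
    show "trans S"
    proof (rule transI)
      fix x y z assume "(x, y) \<in> S" "(y, z) \<in> S"
      obtain a b where ab: "(a, b) \<in> R" "x = h a" "y = h b"
        using \<open>(x, y) \<in> S\<close> by (auto simp: S_def)
      obtain b' c where bc: "(b', c) \<in> R" "y = h b'" "z = h c"
        using \<open>(y, z) \<in> S\<close> by (auto simp: S_def)
      have "b \<in> Q" "b' \<in> Q" using ab bc RQ by auto
      hence "b = b'" using ab bc inj by (simp add: inj_on_def)
      hence "(a, c) \<in> R" using ab bc tr by (auto dest: transD)
      thus "(x, z) \<in> S" using ab bc by (auto simp: S_def)
    qed
    show "antisym S"
    proof (rule antisymI)
      fix x y assume xy: "(x, y) \<in> S" "(y, x) \<in> S"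
      then obtain a b where ab: "(a, b) \<in> R" "x = h a" "y = h b" by (auto simp: S_def)
      hence "a \<in> Q" "b \<in> Q" using RQ by auto
      hence "(b, a) \<in> R" using xy(2) ab S_iff by simp
      thus "x = y" using ab anti by (auto dest: antisymD)
    qed
  qed
  have compat: "compatible (h ` Q) S (h a) (h b) \<longleftrightarrow> compatible Q R a b" if "a \<in> Q" "b \<in> Q" for a b
    using that by (auto simp: compatible_def S_iff)
  have cccS: "ccc (h ` Q) S"
    unfolding ccc_def
  proof (intro allI impI)
    fix A assume A: "A \<subseteq> h ` Q" "\<forall>p\<in>A. \<forall>q\<in>A. p \<noteq> q \<longrightarrow> \<not> compatible (h ` Q) S p q"
    then obtain B where B: "B \<subseteq> Q" "A = h ` B" by (auto simp: subset_image_iff)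
    have "\<forall>p\<in>B. \<forall>q\<in>B. p \<noteq> q \<longrightarrow> \<not> compatible Q R p q"
    proof (intro ballI impI)
      fix p q assume pq: "p \<in> B" "q \<in> B" "p \<noteq> q"
      hence "h p \<noteq> h q" using inj B by (auto simp: inj_on_def)
      thus "\<not> compatible Q R p q" using A(2) B pq compat by blast
    qed
    hence "countable B" using ccc B by (auto simp: ccc_def)
    thus "countable A" using B by simp
  qed
  have "(`) h ` \<D> \<prec> (UNIV :: real set)"
    using image_lepoll small by (rule lesspoll_trans1)
  moreover have "dense_in (h ` Q) S E" if E: "E \<in> (`) h ` \<D>" for E
  proof -
    obtain D where D: "D \<in> \<D>" "E = h ` D" using E by blast
    have DQ: "D \<subseteq> Q" using dense[OF D(1)] by (simp add: dense_in_def)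
    show ?thesis unfolding dense_in_def
    proof (intro conjI ballI)
      show "E \<subseteq> h ` Q" using D DQ by blast
      fix p assume "p \<in> h ` Q"
      then obtain a where a: "a \<in> Q" "p = h a" by blast
      then obtain d where d: "d \<in> D" "(d, a) \<in> R" using dense[OF D(1)] by (auto simp: dense_in_def)
      thus "\<exists>d\<in>E. (d, p) \<in> S" using a D by (auto simp: S_def)
    qed
  qed
  moreover have "h ` Q \<noteq> {}" using ne by simp
  ultimately have "\<exists>G. filter_in (h ` Q) S G \<and> (\<forall>E\<in>(`) h ` \<D>. G \<inter> E \<noteq> {})"
    by (intro martins_axiom_onD[OF MA _ poS cccS])
  then obtain G where G: "filter_in (h ` Q) S G" "\<forall>E\<in>(`) h ` \<D>. G \<inter> E \<noteq> {}"
    by (elim exE conjE)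
  define H where "H = {a \<in> Q. h a \<in> G}"
  have "G \<subseteq> h ` Q" using G(1) by (simp add: filter_in_def)
  hence GH: "G = h ` H" by (auto simp: H_def)
  have HQ: "H \<subseteq> Q" by (auto simp: H_def)
  have "filter_in Q R H"
    unfolding filter_in_def
  proof (intro conjI ballI impI)
    show "H \<subseteq> Q" by (rule HQ)
    show "H \<noteq> {}" using G(1) GH by (auto simp: filter_in_def)
  next
    fix p q assume pq: "p \<in> H" "q \<in> Q" "(p, q) \<in> R"
    hence "(h p, h q) \<in> S" by (auto simp: S_def)
    hence "h q \<in> G" using G(1) pq by (auto simp: filter_in_def H_def)
    thus "q \<in> H" using pq by (simp add: H_def)
  next
    fix p q assume pq: "p \<in> H" "q \<in> H"
    hence "\<exists>t\<in>G. (t, h p) \<in> S \<and> (t, h q) \<in> S" using G(1) by (simp add: filter_in_def H_def)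
    then obtain a where a: "a \<in> H" "(h a, h p) \<in> S" "(h a, h q) \<in> S" unfolding GH by blast
    moreover have "a \<in> Q" "p \<in> Q" "q \<in> Q" using a pq HQ by auto
    ultimately have "a \<in> H" "(a, p) \<in> R" "(a, q) \<in> R" using S_iff by auto
    thus "\<exists>t\<in>H. (t, p) \<in> R \<and> (t, q) \<in> R" by blast
  qed
  moreover have "H \<inter> D \<noteq> {}" if D: "D \<in> \<D>" for D
  proof -
    have "G \<inter> h ` D \<noteq> {}" using G(2) D by simp
    moreover have "D \<subseteq> Q" using dense[OF D] by (simp add: dense_in_def)
    ultimately show ?thesis by (auto simp: H_def)
  qed
  ultimately show ?thesis by blast
qed

text \<open>A Loewenheim-Skolem argument: pass to a suborder of size at most continuum that is closed
  under common extensions and under extensions into the given dense sets.\<close>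

theorem martins_axiom_imp_on:
  assumes MA: "martins_axiom"
  shows "martins_axiom_on TYPE('p)"
  unfolding martins_axiom_on_def
proof (intro allI impI, elim conjE)
  fix P :: "'p set" and R \<D>
  assume ne: "P \<noteq> {}" and po: "partial_order_on P R" and ccc: "ccc P R"
    and small: "\<D> \<prec> (UNIV :: real set)" and "\<forall>D\<in>\<D>. dense_in P R D"
  hence dense: "\<And>D. D \<in> \<D> \<Longrightarrow> dense_in P R D" by blast
  have RP: "R \<subseteq> P \<times> P" and refl: "\<And>a. a \<in> P \<Longrightarrow> (a, a) \<in> R" and tr: "trans R" and anti: "antisym R"
    using po by (auto simp: partial_order_on_def preorder_on_def refl_on_def)
  obtain p0 where p0: "p0 \<in> P" using ne by blast
  define e where "e = (\<lambda>(p, D). SOME d. d \<in> D \<and> (d, p) \<in> R)"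
  define c where "c = (\<lambda>(p, q). if compatible P R p q then SOME t. t \<in> P \<and> (t, p) \<in> R \<and> (t, q) \<in> R else p0)"
  have e: "e (p, D) \<in> D \<and> (e (p, D), p) \<in> R" if "p \<in> P" "D \<in> \<D>" for p D
  proof -
    have "\<exists>d. d \<in> D \<and> (d, p) \<in> R" using dense[OF that(2)] that(1) unfolding dense_in_def by blast
    thus ?thesis unfolding e_def prod.case by (rule someI_ex)
  qed
  have c: "c (p, q) \<in> P \<and> (c (p, q), p) \<in> R \<and> (c (p, q), q) \<in> R" if "compatible P R p q" for p q
  proof -
    have "\<exists>t. t \<in> P \<and> (t, p) \<in> R \<and> (t, q) \<in> R" using that unfolding compatible_def by blast
    hence "(SOME t. t \<in> P \<and> (t, p) \<in> R \<and> (t, q) \<in> R) \<in> P \<and>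
        (SOME t. t \<in> P \<and> (t, p) \<in> R \<and> (t, q) \<in> R, p) \<in> R \<and>
        (SOME t. t \<in> P \<and> (t, p) \<in> R \<and> (t, q) \<in> R, q) \<in> R" by (rule someI_ex)
    thus ?thesis unfolding c_def prod.case using that by simp
  qed
  have cP: "c (p, q) \<in> P" for p q
    using c[of p q] p0 by (cases "compatible P R p q") (auto simp: c_def)
  define Qs where "Qs = rec_nat {p0} (\<lambda>_ X. X \<union> (e ` (X \<times> \<D>) \<union> c ` (X \<times> X)))"
  have Qs0: "Qs 0 = {p0}" and QsSuc: "\<And>n. Qs (Suc n) = Qs n \<union> (e ` (Qs n \<times> \<D>) \<union> c ` (Qs n \<times> Qs n))"
    by (simp_all add: Qs_def)
  define Q where "Q = (\<Union>n. Qs n)"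
  have small': "\<D> \<lesssim> (UNIV :: real set)" using small by (rule lesspoll_imp_lepoll)
  have "Qs n \<lesssim> (UNIV :: real set)" for n
  proof (induction n)
    case 0
    have "{p0} \<lesssim> (UNIV :: real set)" by (auto simp: lepoll_def inj_on_def)
    thus ?case by (simp add: Qs0)
  next
    case (Suc n)
    show ?case unfolding QsSuc
      by (intro lepoll_real_Un lepoll_trans[OF image_lepoll] lepoll_real_Times Suc small')
  qed
  hence "Q \<lesssim> (UNIV :: real set)" unfolding Q_def by (rule lepoll_real_UN)
  then obtain h :: "'p \<Rightarrow> real" where h: "inj_on h Q" by (auto simp: lepoll_def)
  have "Qs n \<subseteq> P" for n
  proof (induction n)
    case (Suc n)
    have "e ` (Qs n \<times> \<D>) \<subseteq> P" using Suc e RP by blast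
    moreover have "c ` (Qs n \<times> Qs n) \<subseteq> P" using cP by blast
    ultimately show ?case using Suc by (simp add: QsSuc)
  qed (simp add: Qs0 p0)
  hence QP: "Q \<subseteq> P" by (auto simp: Q_def)
  have neQ: "Q \<noteq> {}" using Qs0 by (auto simp: Q_def)
  have mono: "Qs m \<subseteq> Qs n" if "m \<le> n" for m n
    using that by (rule lift_Suc_mono_le[rotated]) (auto simp: QsSuc)
  have eQ: "e (p, D) \<in> Q" if p: "p \<in> Q" and D: "D \<in> \<D>" for p D
  proof -
    obtain n where "p \<in> Qs n" using p by (auto simp: Q_def)
    hence "e (p, D) \<in> Qs (Suc n)" using D by (auto simp: QsSuc)
    thus ?thesis by (auto simp: Q_def)
  qed
  have cQ: "c (p, q) \<in> Q" if p: "p \<in> Q" and q: "q \<in> Q" for p q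
  proof -
    obtain m n where "p \<in> Qs m" "q \<in> Qs n" using p q by (auto simp: Q_def)
    hence "p \<in> Qs (max m n)" "q \<in> Qs (max m n)"
      using mono[of m "max m n"] mono[of n "max m n"] by auto
    hence "c (p, q) \<in> Qs (Suc (max m n))" by (auto simp: QsSuc)
    thus ?thesis by (auto simp: Q_def)
  qed
  define S where "S = R \<inter> (Q \<times> Q)"
  have poQ: "partial_order_on Q S"
    unfolding partial_order_on_def preorder_on_def
  proof (intro conjI)
    show "refl_on Q S" using refl QP by (auto simp: refl_on_def S_def)
    show "trans S" using tr by (auto simp: trans_def S_def)
    show "antisym S" using anti by (auto simp: antisym_def S_def)
  qed (auto simp: S_def)
  have cccQ: "ccc Q S"
    unfolding ccc_def
  proof (intro allI impI)
    fix A assume A: "A \<subseteq> Q" "\<forall>p\<in>A. \<forall>q\<in>A. p \<noteq> q \<longrightarrow> \<not> compatible Q S p q"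
    have "compatible Q S p q" if "p \<in> A" "q \<in> A" "compatible P R p q" for p q
    proof -
      have "p \<in> Q" "q \<in> Q" using that A by auto
      thus ?thesis using c[OF that(3)] cQ unfolding compatible_def S_def by blast
    qed
    hence "\<forall>p\<in>A. \<forall>q\<in>A. p \<noteq> q \<longrightarrow> \<not> compatible P R p q" using A by blast
    moreover have "A \<subseteq> P" using A QP by blast
    ultimately show "countable A" using ccc by (simp add: ccc_def)
  qed
  have "(\<lambda>D. D \<inter> Q) ` \<D> \<prec> (UNIV :: real set)"
    using image_lepoll small by (rule lesspoll_trans1)
  moreover have "dense_in Q S E" if E: "E \<in> (\<lambda>D. D \<inter> Q) ` \<D>" for E
  proof -
    obtain D where D: "D \<in> \<D>" "E = D \<inter> Q" using E by blast
    show ?thesis unfolding dense_in_def D(2)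
    proof (intro conjI ballI)
      fix p assume p: "p \<in> Q"
      hence "e (p, D) \<in> D \<inter> Q" "(e (p, D), p) \<in> S"
        using e[of p D] eQ[of p D] D QP by (auto simp: S_def)
      thus "\<exists>d\<in>D \<inter> Q. (d, p) \<in> S" by blast
    qed simp
  qed
  ultimately have "\<exists>G. filter_in Q S G \<and> (\<forall>E\<in>(\<lambda>D. D \<inter> Q) ` \<D>. G \<inter> E \<noteq> {})"
    by (intro martins_axiom_on_transfer[OF MA h neQ poQ cccQ])
  then obtain G where G: "filter_in Q S G" "\<forall>E\<in>(\<lambda>D. D \<inter> Q) ` \<D>. G \<inter> E \<noteq> {}"
    by (elim exE conjE)
  define H where "H = {q \<in> P. \<exists>p\<in>G. (p, q) \<in> R}"
  have GQ: "G \<subseteq> Q" using G(1) by (simp add: filter_in_def)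
  have GH: "G \<subseteq> H" using GQ QP refl by (auto simp: H_def)
  have "filter_in P R H"
    unfolding filter_in_def
  proof (intro conjI ballI impI)
    show "H \<subseteq> P" by (auto simp: H_def)
    show "H \<noteq> {}" using G(1) GH by (auto simp: filter_in_def)
  next
    fix p q assume "p \<in> H" "q \<in> P" "(p, q) \<in> R"
    thus "q \<in> H" using tr by (auto simp: H_def dest: transD)
  next
    fix p q assume "p \<in> H" "q \<in> H"
    then obtain p' q' where *: "p' \<in> G" "q' \<in> G" "(p', p) \<in> R" "(q', q) \<in> R" by (auto simp: H_def)
    then obtain t where t: "t \<in> G" "(t, p') \<in> R" "(t, q') \<in> R"
      using G(1) unfolding filter_in_def S_def by blast
    hence "(t, p) \<in> R" "(t, q) \<in> R" using * tr by (auto dest: transD)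
    thus "\<exists>t\<in>H. (t, p) \<in> R \<and> (t, q) \<in> R" using t GH by blast
  qed
  moreover have "\<forall>D\<in>\<D>. H \<inter> D \<noteq> {}"
  proof
    fix D assume "D \<in> \<D>"
    hence "G \<inter> (D \<inter> Q) \<noteq> {}" using G(2) by simp
    thus "H \<inter> D \<noteq> {}" using GH by blast
  qed
  ultimately show "\<exists>G. filter_in P R G \<and> (\<forall>D\<in>\<D>. G \<inter> D \<noteq> {})"
    by (intro exI[of _ H] conjI)
qed

end

theory Submission
  imports Defs
begin

text \<open>
  Under Martin's Axiom the meager sets of reals have a cofinal subfamily \<open>C\<close> that is a chain under
  inclusion. Order the reals by the time at which the chain swallows them, late points first, and
  put the countable set of rationals, which is meager, on top of everything else. Let \<open>f\<close> select
  the smaller of two points.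

  Every interval \<open>(r, s]\<close> of \<open>f\<close> is meager: apart from rationals, its points are swallowed no later
  than \<open>r\<close>, so they all lie in any member of \<open>C\<close> that contains \<open>r\<close>. Hence a set covered by
  countably many intervals is meager. Conversely, a meager set lies in some \<open>N\<close> in \<open>C\<close>. An
  irrational \<open>r\<close> outside \<open>N\<close> precedes all irrational points of \<open>N\<close>, and a rational \<open>s\<close> follows
  them, so the one interval \<open>(r, s]\<close> contains all of them, together with \<open>s\<close>. Nothing else
  constrains \<open>r\<close> and \<open>s\<close>: by the Baire category theorem such \<open>r\<close> exist arbitrarily close
  to every rational \<open>s\<close>, and the intervals obtained by letting \<open>s\<close> run through all rationals cover
  \<open>N\<close> and all rationals with total length as small as desired.

  For the chain, there are only continuum many countable unions of closed nowhere dense sets, and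
  they are cofinal among the meager sets. Well-order them in the type of the continuum and take the
  unions of the initial segments. That these unions are still meager is the theorem of Martin and
  Solovay that fewer than continuum many meager sets have a meager union, and this is the only place
  where Martin's Axiom enters.
\<close>

section \<open>Meager sets through dense open sets\<close>

text \<open>The dual form, in terms of dense open sets, in which both the Baire category theorem and
  Martin's Axiom apply to meager sets.\<close>

lemma meager_iff_dense_open:
  "meager (A :: 'a::topological_space set) \<longleftrightarrow>
     (\<exists>U :: nat \<Rightarrow> 'a set. (\<forall>n. open (U n) \<and> closure (U n) = UNIV) \<and> A \<inter> (\<Inter>n. U n) = {})"
proof
  assume "meager A"
  then obtain B where B: "\<And>n::nat. nowhere_dense (B n)" "A = (\<Union>n. B n)"
    unfolding meager_def by blast
  have "\<forall>n. open (- closure (B n)) \<and> closure (- closure (B n)) = UNIV"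
    using B(1) by (auto simp: nowhere_dense_def closure_complement)
  moreover have "A \<inter> (\<Inter>n. - closure (B n)) = {}"
    using B(2) closure_subset by fastforce
  ultimately show "\<exists>U :: nat \<Rightarrow> 'a set. (\<forall>n. open (U n) \<and> closure (U n) = UNIV) \<and> A \<inter> (\<Inter>n. U n) = {}"
    by (intro exI[of _ "\<lambda>n. - closure (B n)"] conjI)
next
  assume "\<exists>U :: nat \<Rightarrow> 'a set. (\<forall>n. open (U n) \<and> closure (U n) = UNIV) \<and> A \<inter> (\<Inter>n. U n) = {}"
  then obtain U :: "nat \<Rightarrow> 'a set"
    where U: "\<And>n. open (U n)" "\<And>n. closure (U n) = UNIV" "A \<inter> (\<Inter>n. U n) = {}"
    by blast
  have "nowhere_dense (A - U n)" for n
  proof -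
    have "closure (A - U n) \<subseteq> - U n"
      using U(1) by (intro closure_minimal) auto
    hence "interior (closure (A - U n)) \<subseteq> interior (- U n)"
      by (rule interior_mono)
    thus ?thesis using U(2) by (simp add: nowhere_dense_def interior_complement)
  qed
  moreover have "A = (\<Union>n. A - U n)"
    using U(3) by blast
  ultimately show "meager A"
    unfolding meager_def by (intro exI[of _ "\<lambda>n. A - U n"]) blast
qed

lemma meager_subset: "meager B \<Longrightarrow> A \<subseteq> B \<Longrightarrow> meager A"
  unfolding meager_iff_dense_open by blast

lemma meager_empty: "meager {}"
  unfolding meager_iff_dense_open by (intro exI[of _ "\<lambda>_. UNIV"]) simp

lemma meager_UN:
  fixes A :: "nat \<Rightarrow> 'a::topological_space set"
  assumes "\<And>n. meager (A n)"
  shows "meager (\<Union>n. A n)"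
proof -
  obtain U :: "nat \<Rightarrow> nat \<Rightarrow> 'a set" where
    U: "\<And>n k. open (U n k) \<and> closure (U n k) = UNIV" "\<And>n. A n \<inter> (\<Inter>k. U n k) = {}"
    using assms unfolding meager_iff_dense_open by metis
  define V where "V = (\<lambda>j. case prod_decode j of (n, k) \<Rightarrow> U n k)"
  have V: "V (prod_encode (n, k)) = U n k" for n k
    by (simp add: V_def)
  have "(\<Inter>j. V j) \<subseteq> (\<Inter>k. U n k)" for n
  proof
    fix x assume "x \<in> (\<Inter>j. V j)"
    hence "x \<in> V (prod_encode (n, k))" for k by blast
    thus "x \<in> (\<Inter>k. U n k)" by (simp add: V)
  qed
  hence "A n \<inter> (\<Inter>j. V j) = {}" for n
    using U(2)[of n] by (metis disjoint_iff subsetD)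
  hence "(\<Union>n. A n) \<inter> (\<Inter>j. V j) = {}"
    by blast
  moreover have "\<forall>j. open (V j) \<and> closure (V j) = UNIV"
    using U(1) by (simp add: V_def split: prod.split)
  ultimately show ?thesis
    unfolding meager_iff_dense_open by (intro exI[of _ V] conjI)
qed

lemma meager_Un:
  assumes "meager A" "meager B"
  shows "meager (A \<union> B)"
proof -
  have "A \<union> B = (\<Union>n::nat. if n = 0 then A else B)"
    by (auto split: if_splits)
  thus ?thesis using meager_UN[of "\<lambda>n. if n = 0 then A else B"] assms by simp
qed

lemma meager_countable:
  fixes A :: "'a::{perfect_space, t1_space} set"
  assumes "countable A"
  shows "meager A"
proof (cases "A = {}")
  case False
  then obtain e :: "nat \<Rightarrow> 'a" where e: "range e = A"
    using range_from_nat_into[OF False assms] by blast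
  have "nowhere_dense {x :: 'a}" for x
    by (simp add: nowhere_dense_def interior_singleton)
  hence "meager (\<Union>n. {e n})"
    unfolding meager_def by (intro exI[of _ "\<lambda>n. {e n}"]) simp
  moreover have "A = (\<Union>n. {e n})"
    using e by auto
  ultimately show ?thesis by simp
qed (simp add: meager_empty)

lemma meager_complement_dense:
  fixes A :: "'a::{real_normed_vector,heine_borel} set"
  assumes "meager A"
  shows "closure (- A) = UNIV"
proof -
  obtain U :: "nat \<Rightarrow> 'a set"
    where U: "\<And>n. open (U n)" "\<And>n. closure (U n) = UNIV" "A \<inter> (\<Inter>n. U n) = {}"
    using assms unfolding meager_iff_dense_open by blast
  have "UNIV \<subseteq> closure (\<Inter>(range U))"
    by (rule Baire) (use U in auto)
  moreover have "closure (\<Inter>(range U)) \<subseteq> closure (- A)"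
    using U(3) by (intro closure_mono) blast
  ultimately show ?thesis by blast
qed

section \<open>Fewer than continuum many dense open sets under Martin's Axiom\<close>

lemma lesspoll_iff_ordLess: "A \<prec> B \<longleftrightarrow> (card_of A, card_of B) \<in> ordLess"
proof -
  have "A \<prec> B \<longleftrightarrow> \<not> B \<lesssim> A"
  proof
    show "A \<prec> B \<Longrightarrow> \<not> B \<lesssim> A"
      using lesspoll_trans1[of B A B] by auto
    show "\<not> B \<lesssim> A \<Longrightarrow> A \<prec> B"
      using ordLeq_total[OF card_of_Well_order card_of_Well_order, of A B]
      using eqpoll_imp_lepoll[OF eqpoll_sym, of A B]
      by (auto simp: lesspoll_def lepoll_def card_of_ordLeq)
  qed
  thus ?thesis
    using card_of_ordLess[of B A] by (simp add: lepoll_def)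
qed

lemma countable_lesspoll_real:
  assumes "countable A"
  shows "A \<prec> (UNIV :: real set)"
proof -
  have "A \<lesssim> (UNIV :: nat set)"
    using assms by (auto simp: lepoll_def countable_def)
  also have "(UNIV :: nat set) \<prec> Pow (UNIV :: nat set)"
    by (rule lesspoll_Pow_self)
  also have "Pow (UNIV :: nat set) \<approx> (UNIV :: real set)"
    using nat_sets_eqpoll_reals by simp
  finally show ?thesis .
qed

lemma lesspoll_real_Un:
  assumes "A \<prec> (UNIV :: real set)" "B \<prec> (UNIV :: real set)"
  shows "A \<union> B \<prec> (UNIV :: real set)"
  using assms card_of_Un_ordLess_infinite[OF infinite_UNIV_char_0]
  unfolding lesspoll_iff_ordLess by blast

lemma lesspoll_real_Times_nat:
  assumes "A \<prec> (UNIV :: real set)"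
  shows "A \<times> (UNIV :: nat set) \<prec> (UNIV :: real set)"
proof (cases "finite A")
  case True
  thus ?thesis
    by (intro countable_lesspoll_real) (simp add: countable_finite)
next
  case False
  have "A \<times> (UNIV :: nat set) \<lesssim> A \<times> A"
    using False by (intro times_lepoll_mono lepoll_refl) (simp add: infinite_le_lepoll)
  also have "A \<times> A \<approx> A"
    using card_of_Times_same_infinite[OF False] by (simp add: eqpoll_def card_of_ordIso)
  also note assms
  finally show ?thesis .
qed

lemma open_dense_finite_Inter:
  assumes "finite F" "\<And>U. U \<in> F \<Longrightarrow> open U \<and> closure U = UNIV"
  shows "open (\<Inter>F) \<and> closure (\<Inter>F) = UNIV"
  using assms
proof (induction F)
  case (insert U F)
  thus ?case using closure_open_Int_superset[of U "\<Inter>F"] by (simp add: open_Int)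
qed simp

text \<open>A condition \<open>(s, F)\<close> is a finite set \<open>s\<close> of nonempty basic open sets, tagged by natural
  numbers, together with a promise that all sets added later lie in every member
  of the finite subset \<open>F\<close> of \<open>K\<close>. Conditions with the same \<open>s\<close> are compatible, and there are only
  countably many \<open>s\<close>, so the order is ccc. A generic filter yields \<open>V n\<close>, the union of the basic sets
  with tag at least \<open>n\<close>. Density of \<open>V n\<close> comes from adding a set inside a given basic set \<open>b\<close>,
  which is possible because finitely many dense open sets meet in a dense open set. If \<open>U\<close> is in the
  promise of \<open>(s, F)\<close>, then \<open>V n \<subseteq> U\<close> as soon as \<open>n\<close> exceeds the finitely many tags in \<open>s\<close>.\<close>

lemma martins_axiom_dense_open_refinement:
  fixes K :: "'a::second_countable_topology set set"
  assumes MA: martins_axiom and small: "K \<prec> (UNIV :: real set)"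
    and K: "\<And>U. U \<in> K \<Longrightarrow> open U \<and> closure U = UNIV"
  shows "\<exists>V :: nat \<Rightarrow> 'a set. (\<forall>n. open (V n) \<and> closure (V n) = UNIV) \<and> (\<forall>U\<in>K. \<exists>n. V n \<subseteq> U)"
proof -
  obtain B0 :: "'a set set" where B0: "countable B0" "topological_basis B0"
    using ex_countable_basis by blast
  define B where "B = B0 - {{}}"
  have countB: "countable B" using B0 by (simp add: B_def)
  have openB: "open b" "b \<noteq> {}" if "b \<in> B" for b
    using that B0 by (auto simp: B_def topological_basis_open)
  have basis: "\<exists>b\<in>B. b \<subseteq> W" if W: "open W" "W \<noteq> {}" for W
  proof -
    obtain x where "x \<in> W" using W(2) by blast
    with B0(2) W(1) obtain b where "b \<in> B0" "x \<in> b" "b \<subseteq> W"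
      by (rule topological_basisE)
    thus ?thesis unfolding B_def by blast
  qed
  define P where "P = {(s, F) | s F. finite s \<and> s \<subseteq> (UNIV :: nat set) \<times> B \<and> finite F \<and> F \<subseteq> K}"
  define R where "R = {((s', F'), (s, F)) | s' F' s F. (s', F') \<in> P \<and> (s, F) \<in> P \<and> s \<subseteq> s' \<and> F \<subseteq> F' \<and>
                        (\<forall>n b U. (n, b) \<in> s' - s \<longrightarrow> U \<in> F \<longrightarrow> b \<subseteq> U)}"
  have R_iff: "((s', F'), (s, F)) \<in> R \<longleftrightarrow> (s', F') \<in> P \<and> (s, F) \<in> P \<and> s \<subseteq> s' \<and> F \<subseteq> F' \<and>
                        (\<forall>n b U. (n, b) \<in> s' - s \<longrightarrow> U \<in> F \<longrightarrow> b \<subseteq> U)" for s' F' s F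
    by (simp add: R_def)
  have P_iff: "(s, F) \<in> P \<longleftrightarrow> finite s \<and> s \<subseteq> UNIV \<times> B \<and> finite F \<and> F \<subseteq> K" for s F
    by (auto simp: P_def)
  have "({}, {}) \<in> P" by (simp add: P_iff)
  hence ne: "P \<noteq> {}" by blast
  have po: "partial_order_on P R"
    unfolding partial_order_on_def preorder_on_def
  proof (intro conjI)
    show "R \<subseteq> P \<times> P" by (auto simp: R_def)
    show "refl_on P R" by (auto intro!: refl_onI simp: R_iff)
    show "antisym R" by (auto intro!: antisymI simp: R_iff)
    show "trans R"
    proof (rule transI)
      fix x y z assume xy: "(x, y) \<in> R" and yz: "(y, z) \<in> R"
      obtain s1 F1 s2 F2 s3 F3 where e: "x = (s1, F1)" "y = (s2, F2)" "z = (s3, F3)"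
        by (metis surj_pair)
      have 12: "b \<subseteq> U" if "(n, b) \<in> s1 - s2" "U \<in> F2" for n b U
        using that xy unfolding e R_iff by simp
      have 23: "b \<subseteq> U" if "(n, b) \<in> s2 - s3" "U \<in> F3" for n b U
        using that yz unfolding e R_iff by simp
      have sub: "(s1, F1) \<in> P" "(s3, F3) \<in> P" "s3 \<subseteq> s1" "F3 \<subseteq> F2" "F3 \<subseteq> F1"
        using xy yz unfolding e R_iff by auto
      have "b \<subseteq> U" if "(n, b) \<in> s1 - s3" "U \<in> F3" for n b U
        using that sub(4) 12[of n b U] 23[of n b U] by (cases "(n, b) \<in> s2") auto
      thus "(x, z) \<in> R" using sub unfolding e R_iff by simp
    qed
  qed
  have ccc: "ccc P R"
    unfolding ccc_def
  proof (intro allI impI)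
    fix A assume A: "A \<subseteq> P" "\<forall>p\<in>A. \<forall>q\<in>A. p \<noteq> q \<longrightarrow> \<not> compatible P R p q"
    have "inj_on fst A"
    proof (rule inj_onI, rule ccontr)
      fix p q assume pq: "p \<in> A" "q \<in> A" "fst p = fst q" "p \<noteq> q"
      obtain s F F' where e: "p = (s, F)" "q = (s, F')"
        using pq(3) by (metis prod.collapse)
      have "(s, F) \<in> P" "(s, F') \<in> P" using pq A(1) e by auto
      hence "(s, F \<union> F') \<in> P" "((s, F \<union> F'), p) \<in> R" "((s, F \<union> F'), q) \<in> R"
        unfolding e R_iff P_iff by auto
      hence "compatible P R p q" unfolding compatible_def by blast
      thus False using A(2) pq by blast
    qed
    moreover have "fst ` A \<subseteq> {s. finite s \<and> s \<subseteq> UNIV \<times> B}"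
    proof (rule image_subsetI)
      fix p assume "p \<in> A"
      hence "(fst p, snd p) \<in> P" using A(1) by auto
      thus "fst p \<in> {s. finite s \<and> s \<subseteq> UNIV \<times> B}" unfolding P_iff by simp
    qed
    hence "countable (fst ` A)"
      by (rule countable_subset) (intro countable_Collect_finite_subset countable_SIGMA countB uncountable_def, auto)
    ultimately show "countable A" by (blast intro: countable_image_inj_on)
  qed
  define DU where "DU = (\<lambda>U. {(s, F). (s, F) \<in> P \<and> U \<in> F})"
  define DV where "DV = (\<lambda>(n, b). {(s, F). (s, F) \<in> P \<and> (\<exists>m b'. (m, b') \<in> s \<and> n \<le> m \<and> b' \<subseteq> b)})"
  have "dense_in P R (DU U)" if "U \<in> K" for U
    unfolding dense_in_def
  proof (intro conjI ballI)
    fix p assume p: "p \<in> P"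
    obtain s F where e: "p = (s, F)" by fastforce
    have "(s, insert U F) \<in> DU U" "((s, insert U F), p) \<in> R"
      using p that unfolding DU_def e by (auto simp: R_iff P_iff)
    thus "\<exists>d\<in>DU U. (d, p) \<in> R" by blast
  qed (auto simp: DU_def)
  moreover have "dense_in P R (DV (n, b))" if b: "b \<in> B" for n b
    unfolding dense_in_def
  proof (intro conjI ballI)
    fix p assume p: "p \<in> P"
    obtain s F where e: "p = (s, F)" by fastforce
    have sF: "finite s" "s \<subseteq> UNIV \<times> B" "finite F" "F \<subseteq> K"
      using p e by (auto simp: P_iff)
    have F: "open (\<Inter>F)" "closure (\<Inter>F) = UNIV"
      using open_dense_finite_Inter[OF sF(3)] K sF(4) by auto
    have "b \<inter> \<Inter>F \<noteq> {}"
      using openB[OF b] F(2) open_Int_closure_eq_empty[of b "\<Inter>F"] by simp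
    then obtain b' where b': "b' \<in> B" "b' \<subseteq> b \<inter> \<Inter>F"
      using basis[of "b \<inter> \<Inter>F"] openB[OF b] F(1) by auto
    have "(insert (n, b') s, F) \<in> P" using sF b' by (simp add: P_iff)
    hence "(insert (n, b') s, F) \<in> DV (n, b)" "((insert (n, b') s, F), p) \<in> R"
      using b' p unfolding DV_def e by (auto simp: R_iff)
    thus "\<exists>d\<in>DV (n, b). (d, p) \<in> R" by blast
  qed (auto simp: DV_def)
  ultimately have dense: "dense_in P R D" if "D \<in> DU ` K \<union> DV ` (UNIV \<times> B)" for D
    using that by auto
  have "DU ` K \<prec> (UNIV :: real set)"
    using image_lepoll small by (rule lesspoll_trans1)
  moreover have "DV ` (UNIV \<times> B) \<prec> (UNIV :: real set)"
    by (intro countable_lesspoll_real countable_image countable_SIGMA countB) auto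
  ultimately have "DU ` K \<union> DV ` (UNIV \<times> B) \<prec> (UNIV :: real set)"
    by (rule lesspoll_real_Un)
  hence "\<exists>G. filter_in P R G \<and> (\<forall>D\<in>DU ` K \<union> DV ` (UNIV \<times> B). G \<inter> D \<noteq> {})"
    by (rule martins_axiom_onD[OF martins_axiom_imp_on[OF MA] ne po ccc]) (rule dense)
  then obtain G where G: "filter_in P R G"
    and meets: "\<forall>D\<in>DU ` K \<union> DV ` (UNIV \<times> B). G \<inter> D \<noteq> {}"
    by (elim exE conjE)
  define V where "V = (\<lambda>n. \<Union>{b. \<exists>s F m. (s, F) \<in> G \<and> (m, b) \<in> s \<and> n \<le> m})"
  have GP: "G \<subseteq> P" using G(1) by (simp add: filter_in_def)
  have inB: "b \<in> B" if "(s, F) \<in> G" "(m, b) \<in> s" for s F m b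
  proof -
    have "(s, F) \<in> P" using that(1) GP by auto
    hence "s \<subseteq> UNIV \<times> B" by (simp add: P_iff)
    thus ?thesis using that(2) by auto
  qed
  have "open (V n)" for n
    unfolding V_def by (intro open_Union) (auto dest: inB openB(1))
  moreover have "closure (V n) = UNIV" for n
  proof (rule ccontr)
    assume "closure (V n) \<noteq> UNIV"
    then obtain b where b: "b \<in> B" "b \<subseteq> - closure (V n)"
      using basis[of "- closure (V n)"] by auto
    have "G \<inter> DV (n, b) \<noteq> {}" using meets b(1) by simp
    then obtain s F m b' where *: "(s, F) \<in> G" "(m, b') \<in> s" "n \<le> m" "b' \<subseteq> b"
      unfolding DV_def by auto
    hence "b' \<subseteq> V n" unfolding V_def by blast
    moreover have "b' \<noteq> {}" using inB[OF *(1,2)] openB(2) by simp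
    ultimately show False using *(4) b(2) closure_subset[of "V n"] by auto
  qed
  moreover have "\<exists>n. V n \<subseteq> U" if U: "U \<in> K" for U
  proof -
    have "G \<inter> DU U \<noteq> {}" using meets U by simp
    then obtain s F where sF: "(s, F) \<in> G" "U \<in> F" unfolding DU_def by auto
    have "(s, F) \<in> P" using sF(1) GP by auto
    hence "finite (fst ` s)" by (simp add: P_iff)
    then obtain n where "\<forall>m\<in>fst ` s. m < n"
      unfolding finite_nat_set_iff_bounded by (elim exE)
    hence n: "m < n" if "(m, b) \<in> s" for m b
      using that by force
    have "b \<subseteq> U" if b: "(s', F') \<in> G" "(m, b) \<in> s'" "n \<le> m" for s' F' m b
    proof -
      obtain t T where t: "((t, T), (s, F)) \<in> R" "((t, T), (s', F')) \<in> R"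
        using G(1) sF(1) b(1) unfolding filter_in_def by (metis surj_pair)
      have "(m, b) \<in> t" using t(2) b(2) unfolding R_iff by auto
      moreover have "(m, b) \<notin> s" using n[of m b] b(3) by auto
      ultimately show ?thesis using t(1) sF(2) unfolding R_iff by simp
    qed
    hence "V n \<subseteq> U" unfolding V_def
      by (intro Union_least) (elim CollectE exE conjE, simp)
    thus ?thesis ..
  qed
  ultimately show ?thesis
    by (intro exI[of _ V]) simp
qed

text \<open>Each \<open>M i\<close> is disjoint from the intersection of countably many dense open sets \<open>U i n\<close>. All these
  families together still have fewer than continuum many members, and one sequence \<open>V\<close> that refines
  every member of them serves all \<open>M i\<close> at once.\<close>

lemma martins_axiom_meager_UN:
  fixes M :: "'i \<Rightarrow> 'a::second_countable_topology set"
  assumes MA: martins_axiom and small: "I \<prec> (UNIV :: real set)"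
    and M: "\<And>i. i \<in> I \<Longrightarrow> meager (M i)"
  shows "meager (\<Union>i\<in>I. M i)"
proof -
  have "\<forall>i\<in>I. \<exists>U. (\<forall>n::nat. open (U n) \<and> closure (U n) = UNIV) \<and> M i \<inter> (\<Inter>n. U n) = {}"
    using M unfolding meager_iff_dense_open by (rule ballI)
  then obtain U :: "'i \<Rightarrow> nat \<Rightarrow> 'a set"
    where U: "\<forall>i\<in>I. (\<forall>n. open (U i n) \<and> closure (U i n) = UNIV) \<and> M i \<inter> (\<Inter>n. U i n) = {}"
    by (elim bchoice[THEN exE])
  let ?K = "(\<lambda>(i, n). U i n) ` (I \<times> UNIV)"
  have "?K \<prec> (UNIV :: real set)"
    using image_lepoll lesspoll_real_Times_nat[OF small] by (rule lesspoll_trans1)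
  hence "\<exists>V :: nat \<Rightarrow> 'a set. (\<forall>n. open (V n) \<and> closure (V n) = UNIV) \<and> (\<forall>U\<in>?K. \<exists>n. V n \<subseteq> U)"
    by (rule martins_axiom_dense_open_refinement[OF MA]) (use U in auto)
  then obtain V :: "nat \<Rightarrow> 'a set" where V: "\<forall>n. open (V n) \<and> closure (V n) = UNIV"
    "\<forall>U\<in>?K. \<exists>n. V n \<subseteq> U" by (elim exE conjE)
  have "(\<Union>i\<in>I. M i) \<inter> (\<Inter>n. V n) = {}"
  proof (rule ccontr)
    assume "\<not> ?thesis"
    then obtain x i where x: "i \<in> I" "x \<in> M i" "\<And>n. x \<in> V n" by auto
    moreover have "M i \<inter> (\<Inter>n. U i n) = {}" using U x(1) by simp
    ultimately obtain n where "x \<notin> U i n" by blast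
    moreover obtain m where "V m \<subseteq> U i n" using V(2) x(1) by force
    ultimately show False using x(3) by blast
  qed
  thus ?thesis
    unfolding meager_iff_dense_open using V(1) by (intro exI[of _ V] conjI)
qed

section \<open>A cofinal chain of meager sets\<close>

text \<open>A sequence of open sets is coded by the set of pairs \<open>(n, i)\<close> for which the \<open>i\<close>-th basic set
  lies in the \<open>n\<close>-th open set, hence by a set of natural numbers, hence by a real.\<close>

lemma meager_cofinal_real_family:
  "\<exists>g :: real \<Rightarrow> 'a::second_countable_topology set.
     (\<forall>r. meager (g r)) \<and> (\<forall>M. meager M \<longrightarrow> (\<exists>r. M \<subseteq> g r))"
proof -
  obtain B :: "'a set set" where B: "countable B" "topological_basis B"
    using ex_countable_basis by blast
  obtain b :: "nat \<Rightarrow> 'a set" where b: "B \<subseteq> range b"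
    using subset_range_from_nat_into[OF B(1)] by blast
  obtain h :: "real \<Rightarrow> nat set" where "bij h"
    using eqpoll_sym[OF nat_sets_eqpoll_reals] by (auto simp: eqpoll_def)
  hence h: "surj h" by (rule bij_is_surj)
  define G where "G = (\<lambda>r. - (\<Inter>n. \<Union>{b i | i. prod_encode (n, i) \<in> h r}))"
  \<comment> \<open>For a real whose open sets are not all dense, \<open>G r\<close> may fail to be meager.\<close>
  define g where "g = (\<lambda>r. if meager (G r) then G r else {})"
  have "\<exists>r. M \<subseteq> g r" if "meager M" for M
  proof -
    obtain U :: "nat \<Rightarrow> 'a set"
      where U: "\<And>n. open (U n)" "\<And>n. closure (U n) = UNIV" "M \<inter> (\<Inter>n. U n) = {}"
      using \<open>meager M\<close> unfolding meager_iff_dense_open by blast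
    define X where "X = {prod_encode (n, i) | n i. b i \<subseteq> U n}"
    obtain r where hr: "X = h r"
      using surjD[OF h, of X] by blast
    have r: "prod_encode (n, i) \<in> h r \<longleftrightarrow> b i \<subseteq> U n" for n i
      unfolding hr[symmetric] X_def by auto
    have "\<Union>{b i | i. prod_encode (n, i) \<in> h r} = U n" for n
    proof
      show "\<Union>{b i | i. prod_encode (n, i) \<in> h r} \<subseteq> U n"
        unfolding r by auto
      show "U n \<subseteq> \<Union>{b i | i. prod_encode (n, i) \<in> h r}"
      proof
        fix x assume "x \<in> U n"
        then obtain b' where "b' \<in> B" "x \<in> b'" "b' \<subseteq> U n"
          using U(1) B(2) by (metis topological_basisE)
        thus "x \<in> \<Union>{b i | i. prod_encode (n, i) \<in> h r}"
          using b unfolding r by blast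
      qed
    qed
    hence G: "G r = - (\<Inter>n. U n)" by (simp add: G_def)
    have "meager (G r)"
      unfolding G meager_iff_dense_open using U(1,2) by (intro exI[of _ U]) auto
    hence "M \<subseteq> g r" using U(3) G by (auto simp: g_def)
    thus ?thesis ..
  qed
  moreover have "meager (g r)" for r
    by (simp add: g_def meager_empty)
  ultimately show ?thesis
    by (intro exI[of _ g]) simp
qed

text \<open>Proper initial segments of the cardinal well-order of the reals have fewer than continuum many
  elements, so the union of \<open>g\<close> over each of them is meager. Adding \<open>g u\<close> to the union over the
  predecessors of \<open>u\<close> makes the chain cofinal.\<close>

lemma martins_axiom_meager_chain:
  assumes MA: martins_axiom
  shows "\<exists>C :: 'a::second_countable_topology set set. (\<forall>N\<in>C. meager N) \<and>
    (\<forall>N\<in>C. \<forall>N'\<in>C. N \<subseteq> N' \<or> N' \<subseteq> N) \<and> (\<forall>M. meager M \<longrightarrow> (\<exists>N\<in>C. M \<subseteq> N))"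
proof -
  obtain g :: "real \<Rightarrow> 'a set" where g: "\<And>r. meager (g r)" "\<And>M. meager M \<Longrightarrow> \<exists>r. M \<subseteq> g r"
    using meager_cofinal_real_family by blast
  define W where "W = card_of (UNIV :: real set)"
  have W: "Card_order W" "Field W = UNIV"
    unfolding W_def by (rule card_of_Card_order, rule Field_card_of)
  hence "Well_order W" by (simp add: card_order_on_def)
  hence trans: "trans W" and anti: "antisym W" and total: "\<And>u v. u \<noteq> v \<Longrightarrow> (u, v) \<in> W \<or> (v, u) \<in> W"
    using W(2) by (auto simp: order_on_defs total_on_def)
  define N where "N = (\<lambda>u. g u \<union> (\<Union>v\<in>underS W u. g v))"
  have "meager (N u)" for u
  proof -
    have "(card_of (underS W u), card_of (UNIV :: real set)) \<in> ordLess"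
      using card_of_underS[OF W(1), of u] W(2) unfolding W_def by simp
    hence "underS W u \<prec> (UNIV :: real set)"
      by (simp add: lesspoll_iff_ordLess)
    thus ?thesis
      unfolding N_def using g(1) by (intro meager_Un martins_axiom_meager_UN[OF MA])
  qed
  moreover have "N u \<subseteq> N v" if "(u, v) \<in> W" for u v
    using that trans anti unfolding N_def underS_def by (blast dest: transD antisymD)
  hence "N u \<subseteq> N v \<or> N v \<subseteq> N u" for u v
    using total[of u v] by (cases "u = v") auto
  moreover have "\<exists>u. M \<subseteq> N u" if "meager M" for M
    using g(2)[OF that] unfolding N_def by blast
  ultimately show ?thesis
    by (intro exI[of _ "range N"]) simp
qed

section \<open>Weak selections from tournaments\<close>

lemma weak_selection_of_tournament:
  assumes "\<And>x y :: real. x \<noteq> y \<Longrightarrow> lt x y \<longleftrightarrow> \<not> lt y x"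
  shows "\<exists>f. weak_selection f \<and> (\<forall>x y. sel_less f x y \<longleftrightarrow> x \<noteq> y \<and> lt x y)"
proof -
  define f where "f F = (SOME x. x \<in> F \<and> (\<forall>y\<in>F. y \<noteq> x \<longrightarrow> lt x y))" for F
  have f: "f {x, y} = x" if "x \<noteq> y" "lt x y" for x y
    unfolding f_def by (rule some_equality) (use that assms[of x y] in auto)
  have f': "f {x, y} = (if lt x y then x else y)" if "x \<noteq> y" for x y
    using f[of x y] f[of y x] assms[of x y] that by (auto simp: insert_commute)
  have "weak_selection f"
    unfolding weak_selection_def by (auto simp: card_2_iff f')
  moreover have "sel_less f x y \<longleftrightarrow> x \<noteq> y \<and> lt x y" for x y
    by (auto simp: sel_less_def f' split: if_splits)
  ultimately show ?thesis by blast
qed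

text \<open>A null set has at least one countable cover by intervals, since the infimum over no covers
  is infinite.\<close>

lemma sel_null_meager:
  assumes intervals: "\<And>r s. meager (sel_interval f r s)" and A: "A \<in> sel_null f"
  shows "meager A"
proof -
  let ?S = "{(\<Sum>n. ennreal \<bar>s n - r n\<bar>) | r s :: nat \<Rightarrow> real. A \<subseteq> (\<Union>n. sel_interval f (r n) (s n))}"
  have "?S \<noteq> {}"
  proof
    assume *: "?S = {}"
    have "Inf ?S = 0" using A by (simp add: sel_null_def sel_measure_def)
    thus False unfolding * by simp
  qed
  then obtain r s :: "nat \<Rightarrow> real" where "A \<subseteq> (\<Union>n. sel_interval f (r n) (s n))"
    by blast
  thus ?thesis
    using meager_UN[of "\<lambda>n. sel_interval f (r n) (s n)"] intervals meager_subset by blast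
qed

lemma sel_null_of_small_covers:
  assumes "\<And>\<epsilon>::real. \<epsilon> > 0 \<Longrightarrow> \<exists>r s :: nat \<Rightarrow> real. A \<subseteq> (\<Union>n. sel_interval f (r n) (s n)) \<and>
             (\<forall>n. \<bar>s n - r n\<bar> \<le> \<epsilon> * (1/2) ^ Suc n)"
  shows "A \<in> sel_null f"
proof -
  have le: "sel_measure f A \<le> ennreal \<epsilon>" if \<epsilon>: "\<epsilon> > 0" for \<epsilon>
  proof -
    obtain r s :: "nat \<Rightarrow> real" where rs: "A \<subseteq> (\<Union>n. sel_interval f (r n) (s n))"
      "\<And>n. \<bar>s n - r n\<bar> \<le> \<epsilon> * (1/2) ^ Suc n"
      using assms[OF \<epsilon>] by blast
    have "sel_measure f A \<le> (\<Sum>n. ennreal \<bar>s n - r n\<bar>)"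
      unfolding sel_measure_def by (rule Inf_lower) (use rs(1) in blast)
    also have "\<dots> \<le> (\<Sum>n. ennreal (\<epsilon> * (1/2) ^ Suc n))"
      using rs(2) by (intro suminf_le ennreal_leI summableI)
    also have "\<dots> = ennreal (\<epsilon> * 1)"
      using \<epsilon> by (intro suminf_ennreal_eq sums_mult power_half_series) auto
    finally show ?thesis by simp
  qed
  have "sel_measure f A \<le> 0"
    by (rule ennreal_le_epsilon) (simp add: le)
  thus ?thesis by (simp add: sel_null_def)
qed

section \<open>The selection given by a chain of meager sets\<close>

lemma selection_of_cofinal_meager_chain:
  fixes C :: "real set set"
  assumes C: "\<And>N. N \<in> C \<Longrightarrow> meager N"
    and chain: "\<And>N N'. N \<in> C \<Longrightarrow> N' \<in> C \<Longrightarrow> N \<subseteq> N' \<or> N' \<subseteq> N"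
    and cofinal: "\<And>M. meager M \<Longrightarrow> \<exists>N\<in>C. M \<subseteq> N"
  shows "\<exists>f. weak_selection f \<and> sel_null f = {A. meager A}"
proof -
  \<comment> \<open>The sets \<open>S x\<close> are final segments of \<open>C\<close>; a smaller \<open>S x\<close> means that \<open>x\<close> is swallowed later.\<close>
  define S where "S = (\<lambda>x. {N \<in> C. x \<in> N})"
  have S_total: "S x \<subseteq> S y \<or> S y \<subseteq> S x" for x y
    using chain unfolding S_def by blast
  \<comment> \<open>The Euclidean order only breaks ties; any linear order of the reals would do.\<close>
  define lt where "lt = (\<lambda>x y. (x \<notin> \<rat> \<and> y \<in> \<rat>) \<or>
     ((x \<in> \<rat> \<longleftrightarrow> y \<in> \<rat>) \<and> (S x \<subset> S y \<or> (S x = S y \<and> x < y))))"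
  have tournament: "lt x y \<longleftrightarrow> \<not> lt y x" if "x \<noteq> y" for x y
  proof -
    consider "S x = S y" | "S x \<subset> S y" | "S y \<subset> S x"
      using S_total[of x y] by (metis psubsetI)
    thus ?thesis
    proof cases
      case 1
      thus ?thesis using that by (auto simp: lt_def)
    next
      case 2
      hence "\<not> S y \<subset> S x" "S x \<noteq> S y" by auto
      thus ?thesis using 2 unfolding lt_def by auto
    next
      case 3
      hence "\<not> S x \<subset> S y" "S x \<noteq> S y" by auto
      thus ?thesis using 3 unfolding lt_def by auto
    qed
  qed
  have "\<exists>f. weak_selection f \<and> (\<forall>x y. sel_less f x y \<longleftrightarrow> x \<noteq> y \<and> lt x y)"
    by (rule weak_selection_of_tournament) (rule tournament)
  then obtain f where f: "weak_selection f" "\<And>x y. sel_less f x y \<longleftrightarrow> x \<noteq> y \<and> lt x y"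
    by (elim exE conjE) simp
  have rat: "meager (\<rat> :: real set)"
    by (intro meager_countable countable_rat)
  have "meager (sel_interval f r s)" for r s
  proof -
    obtain N where N: "N \<in> C" "r \<in> N"
      using cofinal[OF meager_countable[of "{r}"]] by auto
    have "sel_interval f r s \<subseteq> N \<union> \<rat>"
    proof
      fix x assume "x \<in> sel_interval f r s"
      hence "x \<in> \<rat> \<or> S r \<subseteq> S x"
        unfolding sel_interval_def f(2) lt_def by auto
      moreover have "N \<in> S r" using N by (simp add: S_def)
      ultimately have "x \<in> \<rat> \<or> N \<in> S x" by auto
      thus "x \<in> N \<union> \<rat>" by (auto simp: S_def)
    qed
    with meager_Un[OF C[OF N(1)] rat] show ?thesis by (rule meager_subset)
  qed
  moreover have "A \<in> sel_null f" if A: "meager A" for A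
  proof (rule sel_null_of_small_covers)
    fix \<epsilon> :: real assume \<epsilon>: "\<epsilon> > 0"
    obtain N where N: "N \<in> C" "A \<subseteq> N" using cofinal[OF A] by blast
    obtain s :: "nat \<Rightarrow> real" where s: "range s = \<rat>"
      using range_from_nat_into[OF _ countable_rat] Rats_0 by blast
    have "\<exists>r. r \<notin> N \<union> \<rat> \<and> \<bar>s n - r\<bar> \<le> \<epsilon> * (1/2) ^ Suc n" for n
    proof -
      have "s n \<in> closure (- (N \<union> \<rat>))"
        using meager_complement_dense[OF meager_Un[OF C[OF N(1)] rat]] by blast
      moreover have "\<epsilon> * (1/2) ^ Suc n > 0" using \<epsilon> by simp
      ultimately obtain r where "r \<in> - (N \<union> \<rat>)" "dist r (s n) < \<epsilon> * (1/2) ^ Suc n"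
        unfolding closure_approachable by blast
      thus ?thesis by (intro exI[of _ r]) (auto simp: dist_real_def abs_minus_commute)
    qed
    then obtain r where r: "\<And>n. r n \<notin> N \<union> \<rat>" "\<And>n. \<bar>s n - r n\<bar> \<le> \<epsilon> * (1/2) ^ Suc n"
      by metis
    \<comment> \<open>A rational is the endpoint of its own interval; an irrational point of \<open>A\<close> lies in all of them.\<close>
    have "x \<in> (\<Union>n. sel_interval f (r n) (s n))" if x: "x \<in> A" for x
    proof (cases "x \<in> \<rat>")
      case True
      then obtain n where n: "x = s n" using s by blast
      have "lt (r n) x" "r n \<noteq> x" using r(1)[of n] True by (auto simp: lt_def)
      hence "x \<in> sel_interval f (r n) (s n)"
        unfolding sel_interval_def sel_le_def f(2) using n by simp
      thus ?thesis by blast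
    next
      case False
      have xN: "x \<in> N" using x N(2) by blast
      have "N \<in> S x" "N \<notin> S (r 0)" using xN N(1) r(1)[of 0] by (simp_all add: S_def)
      hence "S (r 0) \<subset> S x" using S_total[of x "r 0"] by blast
      hence "lt (r 0) x" "r 0 \<noteq> x" using r(1)[of 0] False unfolding lt_def by auto
      moreover have "s 0 \<in> \<rat>" using s by blast
      hence "lt x (s 0)" "x \<noteq> s 0" using False unfolding lt_def by auto
      ultimately have "x \<in> sel_interval f (r 0) (s 0)"
        unfolding sel_interval_def sel_le_def f(2) by simp
      thus ?thesis by blast
    qed
    hence "A \<subseteq> (\<Union>n. sel_interval f (r n) (s n))" by blast
    thus "\<exists>r s :: nat \<Rightarrow> real. A \<subseteq> (\<Union>n. sel_interval f (r n) (s n)) \<and>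
             (\<forall>n. \<bar>s n - r n\<bar> \<le> \<epsilon> * (1/2) ^ Suc n)"
      using r(2) by blast
  qed
  ultimately have "sel_null f = {A. meager A}"
    using sel_null_meager[of f] by (intro equalityI subsetI CollectI) simp_all
  thus ?thesis using f(1) by blast
qed

theorem corollary3p3:
  assumes "martins_axiom"
  shows "\<exists>f. weak_selection f \<and> sel_null f = {A :: real set. meager A}"
proof -
  obtain C :: "real set set" where "\<forall>N\<in>C. meager N"
    "\<forall>N\<in>C. \<forall>N'\<in>C. N \<subseteq> N' \<or> N' \<subseteq> N" "\<forall>M. meager M \<longrightarrow> (\<exists>N\<in>C. M \<subseteq> N)"
    using martins_axiom_meager_chain[OF assms] by (elim exE conjE)
  thus ?thesis
    by (intro selection_of_cofinal_meager_chain[of C]) simp_all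
qed

end
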